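(* Let $\ell\geq 2$ and $n=4\ell+2$. Then $\mathrm{capt}(H(n),3)=2\ell+3(n-4)$.
   Context: The graph $H(7)$ has vertex set $\{1,\dots,7\}$: vertices $6,2,1,4$ form a path $6-2-1-4$; vertices $3$ and $5$ are each adjacent to all of $6,2,1,4$ and not adjacent to each other; vertex $7$ is adjacent exactly to $6$, $4$ and $3$. For $n\geq 8$, $H(n)$ is obtained from $H(n-1)$ by adding vertex $n$ adjacent exactly to $n-1$, $n-3$ and $n-4$. All graphs are reflexive (every vertex is considered adjacent to itself). The game of $k$ cops and $m$ robbers on $G$: in round 0 the cops first choose starting vertices, then the robbers choose theirs. In each round $i\geq 1$, all cops move (each to an adjacent vertex or staying), then all robbers move likewise. Several players may occupy the same vertex. Whenever a cop and some robbers occupy the same vertex, those robbers are captured and take no further part in the game. Both sides have full information. The cops win if all robbers are captured after finitely many rounds. For a cop-win graph $G$, $\mathrm{capt}(G,m)$ is the index of the round in which the last robber is captured when one cop plays to minimize this index and $m$ robbers play to maximize it. ($H(n)$ is cop-win.) *)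

theory Defs
  imports Main
begin

text \<open>Edges of H(7), listed as unordered pairs (u, v).\<close>
definition H7_edges :: "(nat \<times> nat) set" where
  "H7_edges = {(6,2), (2,1), (1,4),
               (3,6), (3,2), (3,1), (3,4),
               (5,6), (5,2), (5,1), (5,4),
               (7,6), (7,4), (7,3)}"

text \<open>Non-loop edge relation of H(n) (n \<ge> 7) on the vertex set {1..n}:
  the edges of H(7), plus, for each 8 \<le> k \<le> n, edges from k to k-1, k-3, k-4.\<close>
definition H_edge :: "nat \<Rightarrow> nat \<Rightarrow> nat \<Rightarrow> bool" where
  "H_edge n u v \<longleftrightarrow>
     u \<in> {1..n} \<and> v \<in> {1..n} \<and>
     ((u, v) \<in> H7_edges \<or> (v, u) \<in> H7_edges \<or>
      (8 \<le> v \<and> v \<le> n \<and> u \<in> {v - 1, v - 3, v - 4}) \<or>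
      (8 \<le> u \<and> u \<le> n \<and> v \<in> {u - 1, u - 3, u - 4}))"

definition H_vertices :: "nat \<Rightarrow> nat set" where
  "H_vertices n = {1..n}"

definition legal_move :: "nat set \<Rightarrow> (nat \<Rightarrow> nat \<Rightarrow> bool) \<Rightarrow> nat \<Rightarrow> nat \<Rightarrow> bool" where
  "legal_move V E u v \<longleftrightarrow> v \<in> V \<and> (v = u \<or> E u v)"

text \<open>cop_wins_within V E t c rs: at the end of some round, the cop is at c and the
  still active robbers are at the positions listed in rs. Then the cop can guarantee
  that all robbers are captured within the next t rounds. In a round the cop moves
  (capturing robbers on its new vertex), then every remaining robber moves (robbers
  landing on the cop's vertex are captured).\<close>
fun cop_wins_within :: "nat set \<Rightarrow> (nat \<Rightarrow> nat \<Rightarrow> bool) \<Rightarrow> nat \<Rightarrow> nat \<Rightarrow> nat list \<Rightarrow> bool" where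
  "cop_wins_within V E 0 c rs \<longleftrightarrow> rs = []"
| "cop_wins_within V E (Suc t) c rs \<longleftrightarrow> rs = [] \<or>
     (\<exists>c'. legal_move V E c c' \<and>
        (\<forall>rs'. list_all2 (legal_move V E) (filter (\<lambda>r. r \<noteq> c') rs) rs' \<longrightarrow>
               cop_wins_within V E t c' (filter (\<lambda>r. r \<noteq> c') rs')))"

text \<open>The cop can guarantee that the last of m robbers is captured in round at most T
  (round 0 = placement: the cop chooses a start vertex, then the robbers choose theirs;
   robbers placed on the cop are captured in round 0).\<close>
definition capt_le :: "nat set \<Rightarrow> (nat \<Rightarrow> nat \<Rightarrow> bool) \<Rightarrow> nat \<Rightarrow> nat \<Rightarrow> bool" where
  "capt_le V E m T \<longleftrightarrow>
     (\<exists>c0 \<in> V. \<forall>rs0. length rs0 = m \<and> set rs0 \<subseteq> V \<longrightarrow>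
        cop_wins_within V E T c0 (filter (\<lambda>r. r \<noteq> c0) rs0))"

definition capt :: "nat set \<Rightarrow> (nat \<Rightarrow> nat \<Rightarrow> bool) \<Rightarrow> nat \<Rightarrow> nat" where
  "capt V E m = (LEAST T. capt_le V E m T)"

end

theory Submission
  imports Defs
begin

text \<open>In H(n), distinct u and v are adjacent iff their difference is 1, 3 or 4 or they are 1 and 3.
  With this description, the number of rounds in which the cop at c captures a single robber
  at r has a closed form whose maximum is T = (n - 4) + l, attained by a cop near vertex n.
  Upper bound: from vertex 1 the cop catches any robber in at most n - 4 rounds, and thereafter
  hunts one robber after another, at most T rounds each.
  Lower bound: the robbers all stand on one vertex and play as a single robber. The last robber
  move forced on them is from n, with the cop on n - 4; there they spread over n, n - 1 and n - 3.
  The cop takes only one of them, and the others can regroup at once on a common vertex whose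
  capture time is T again.\<close>

section \<open>Adjacency in H(n) in terms of differences\<close>

lemma mod_4_eq: "(x + j) mod 4 = (x + k) mod 4 \<longleftrightarrow> j mod 4 = k mod (4::nat)"
proof (induction x)
  case 0
  then show ?case by simp
next
  case (Suc x)
  have "Suc a mod 4 = Suc b mod 4 \<longleftrightarrow> a mod 4 = b mod 4" for a b :: nat
    by (auto simp: mod_Suc)
  with Suc show ?case by simp
qed
definition near :: "nat \<Rightarrow> nat \<Rightarrow> bool" where
  "near u v \<longleftrightarrow> u = v \<or> u = v + 1 \<or> v = u + 1 \<or> u = v + 3 \<or> v = u + 3 \<or>
     u = v + 4 \<or> v = u + 4 \<or> (u = 1 \<and> v = 3) \<or> (u = 3 \<and> v = 1)"

lemma near_refl [simp]: "near u u"
  by (simp add: near_def)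

text \<open>The differences 0, 1, 3, 4 and their negatives are never 2 modulo 4; only the edge 1-3
  shifts a residue by 2. This decides which residues a player can reach in one step.\<close>

lemma near_mod_4:
  assumes "near u v"
  shows "(u + 2) mod 4 \<noteq> v mod 4 \<or> {u, v} = {1, 3}"
  using assms mod_4_eq[of v 2 0] mod_4_eq[of v 3 0] mod_4_eq[of v 5 0] mod_4_eq[of v 6 0]
    mod_4_eq[of u 2 1] mod_4_eq[of u 2 3] mod_4_eq[of u 2 4]
  unfolding near_def by (elim disjE conjE) (simp_all add: ac_simps, auto)

abbreviation moves :: "nat \<Rightarrow> nat \<Rightarrow> nat \<Rightarrow> bool" where
  "moves n \<equiv> legal_move (H_vertices n) (H_edge n)"

abbreviation wins :: "nat \<Rightarrow> nat \<Rightarrow> nat \<Rightarrow> nat list \<Rightarrow> bool" where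
  "wins n \<equiv> cop_wins_within (H_vertices n) (H_edge n)"

lemma H7_edges_near:
  assumes "u \<in> {1..7}" "v \<in> {1..7}"
  shows "(u, v) \<in> H7_edges \<or> (v, u) \<in> H7_edges \<longleftrightarrow> near u v \<and> u \<noteq> v"
proof -
  have "x \<in> {1, 2, 3, 4, 5, 6, 7}" if "x \<in> {1..7}" for x :: nat
    using that by simp presburger
  then have "u \<in> {1, 2, 3, 4, 5, 6, 7}" "v \<in> {1, 2, 3, 4, 5, 6, 7}" using assms by blast+
  then show ?thesis
    by (elim insertE emptyE; hypsubst; simp add: H7_edges_def near_def)
qed

lemma H7_edges_le: "(u, v) \<in> H7_edges \<Longrightarrow> u \<in> {1..7} \<and> v \<in> {1..7}"
  by (auto simp: H7_edges_def)

lemma moves_iff: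
  assumes "n \<ge> 7" "u \<in> {1..n}"
  shows "moves n u v \<longleftrightarrow> v \<in> {1..n} \<and> near u v"
proof (cases "u \<le> 7 \<and> v \<le> 7")
  case True
  then show ?thesis
    using assms H7_edges_near[of u v]
    by (auto simp: legal_move_def H_vertices_def H_edge_def near_def)
next
  case False
  then have "(u, v) \<notin> H7_edges" "(v, u) \<notin> H7_edges" using H7_edges_le by fastforce+
  moreover have "8 \<le> b \<and> a \<in> {b - 1, b - 3, b - 4} \<longleftrightarrow> 8 \<le> b \<and> (b = a + 1 \<or> b = a + 3 \<or> b = a + 4)"
    for a b :: nat by auto
  ultimately have "moves n u v \<longleftrightarrow> v \<in> {1..n} \<and>
      (v = u \<or> 8 \<le> v \<and> (v = u + 1 \<or> v = u + 3 \<or> v = u + 4) \<or>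
       8 \<le> u \<and> (u = v + 1 \<or> u = v + 3 \<or> u = v + 4))"
    using assms unfolding legal_move_def H_vertices_def H_edge_def by auto
  then show ?thesis
    using False unfolding near_def by linarith
qed

section \<open>The capture time of one robber\<close>

text \<open>The number of rounds needed against one robber. A robber behind the cop, or at distance 2
  modulo 4 in front of him, forces the cop back to vertex 1 or 2 (by steps of 4) before he can
  start pushing it towards n.\<close>
definition delay :: "nat \<Rightarrow> nat \<Rightarrow> nat \<Rightarrow> nat" where
  "delay n c r =
     (if c = r then 0
      else if near c r then 1
      else if r < c \<or> (c \<noteq> 1 \<and> (r - c) mod 4 = 2) then n - 4 + (c + 1) div 4
      else if (r - c) mod 4 = 1 then n - 3 - c
      else if (r - c) mod 4 = 2 then n - 4 - c
      else if (r - c) mod 4 = 3 then n - 5 - c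
      else n - 6 - c)"

lemma delay_le:
  assumes "1 \<le> c" "n \<ge> 6"
  shows "delay n c r \<le> n - 4 + (c + 1) div 4"
  using assms by (auto simp: delay_def)

lemma delay_le_max:
  assumes "c \<in> {1..n}" "n \<ge> 6"
  shows "delay n c r \<le> n - 4 + (n + 1) div 4"
proof -
  have "(c + 1) div 4 \<le> (n + 1) div 4" using assms by (intro div_le_mono) auto
  then show ?thesis using delay_le[of c n r] assms by auto
qed

text \<open>Truncated subtraction does no harm here: a robber out of reach and ahead by residue 0, 1
  or 3 is at least 8, 5 or 7 vertices ahead, so r <= n keeps n - 6 - c, n - 3 - c and n - 5 - c at 2
  or more.\<close>

lemma delay_gt_1:
  assumes "\<not> near c r" "c \<in> {1..n}" "r \<in> {1..n}" "n \<ge> 6"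
  shows "delay n c r > 1"
proof (cases "r < c")
  case True
  then show ?thesis using assms by (auto simp: delay_def near_def)
next
  case False
  define q m where "q = (r - c) div 4" and "m = (r - c) mod 4"
  have r: "r = c + (4 * q + m)" and m: "m < 4"
    using False unfolding q_def m_def by simp_all
  then have "m = 0 \<or> m = 1 \<or> m = 2 \<or> m = 3" by auto
  then show ?thesis
    using assms r by (elim disjE; cases q; auto simp: delay_def near_def)
qed

lemma delay_forward_le:
  assumes "c \<le> r" "(r - c) mod 4 \<noteq> 2"
  shows "delay n c r \<le> max 1 (n - 3 - c)"
  using assms by (auto simp: delay_def)

section \<open>Elementary moves of the cop and of one robber\<close>

text \<open>A retreat by 4, or from 3 or 4 to 1, lowers \<open>(c + 1) div 4\<close>, so
  \<open>delay_le\<close> suffices whatever the robber does. At c = 2 this quotient is already 0;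
  there \<open>r mod 4 = 0\<close> keeps the robber off residue 2 modulo 4, the only one where the
  delay from vertex 1 can reach n - 4.\<close>

lemma chase_step_back:
  assumes "n \<ge> 6" "c \<in> {2..n}" "c \<noteq> 2 \<or> r mod 4 = 0" "delay n c r = n - 4 + (c + 1) div 4"
  obtains c' where "c' \<in> {1..n}" "near c c'"
    "\<And>r'. r' \<in> {1..n} \<Longrightarrow> near r r' \<Longrightarrow> delay n c' r' < delay n c r"
proof (cases "c = 2")
  case True
  have "delay n 1 r' < delay n c r" if r': "r' \<in> {1..n}" "near r r'" for r'
  proof -
    have "r mod 4 = 0" using assms(3) True by simp
    then have "r' mod 4 \<noteq> 2" using near_mod_4[OF r'(2)] by (auto simp: doubleton_eq_iff mod_Suc)
    moreover obtain s where "r' = Suc s" using r'(1) by (cases r') auto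
    ultimately have "(r' - 1) mod 4 \<noteq> 1" by (auto simp: mod_Suc)
    then have "delay n 1 r' \<le> n - 5" using r' assms(1) by (auto simp: delay_def)
    then show ?thesis using assms True by simp
  qed
  then show thesis using that[of 1] True assms by (auto simp: near_def)
next
  case False
  define c' where "c' = (if c \<ge> 5 then c - 4 else 1)"
  have c': "(c' + 1) div 4 < (c + 1) div 4" "near c c'" "c' \<in> {1..n}"
    using False assms unfolding c'_def near_def by auto
  have "delay n c' r' < delay n c r" for r'
    using delay_le[of c' n r'] c' assms by auto
  then show thesis using that c' by blast
qed

text \<open>If the distance is congruent to 0, 1 or 3 modulo 4, a step of the same residue leaves only
  distances congruent to 0, 1 or 3 after every robber move.\<close>
lemma chase_step_forward:
  assumes "n \<ge> 10" "c \<in> {1..n}" "r \<in> {1..n}" "\<not> near c r" "c < r"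
    and m: "m \<in> {1, 3, 4}" "r = c + (4 * q + m)"
  obtains c' where "c' \<in> {1..n}" "near c c'"
    "\<And>r'. r' \<in> {1..n} \<Longrightarrow> near r r' \<Longrightarrow> delay n c' r' < delay n c r"
proof -
  have q: "q \<ge> 1" using assms unfolding near_def by (cases q) auto
  have "delay n c r = n - 2 - (c + m)"
    using assms by (auto simp: delay_def)
  moreover have "delay n (c + m) r' \<le> max 1 (n - 3 - (c + m))"
    if r': "r' \<in> {1..n}" "near r r'" for r'
  proof (rule delay_forward_le)
    show "c + m \<le> r'" using r' q m assms unfolding near_def by auto
    obtain p where "q = Suc p" using q by (cases q) auto
    then have r: "r = c + m + 4 * p + 4" using m by simp
    \<comment> \<open>The robber stands 4 above this base, so its moves give j = 0, 1, 3, 4, 5, 7,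
      8, none congruent to 2. Since r >= 6, the edge 1-3 does not interfere.\<close>
    define j where "j = r' - (c + m + 4 * p)"
    have "r' = r \<or> r' = r + 1 \<or> r' + 1 = r \<or> r' = r + 3 \<or> r' + 3 = r \<or> r' = r + 4 \<or> r' + 4 = r"
      using r'(2) r m(1) unfolding near_def by auto
    then have "r' = c + m + (4 * p + j)" "j \<in> {0, 1, 3, 4, 5, 7, 8}"
      unfolding j_def r by (elim disjE; simp)+
    then have "r' - (c + m) = 4 * p + j" "j mod 4 \<noteq> 2" by (simp, auto)
    then show "(r' - (c + m)) mod 4 \<noteq> 2" by simp
  qed
  moreover have "c + m + 4 \<le> n" using m(2) q assms(3) by simp
  ultimately have "delay n (c + m) r' < delay n c r" if "r' \<in> {1..n}" "near r r'" for r'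
    using that by fastforce
  then show thesis
    using that[of "c + m"] m assms(2) \<open>c + m + 4 \<le> n\<close> by (auto simp: near_def)
qed

text \<open>A step changes the vertex by at most 4. Hence the large value n - 4 + (c + 1) div 4
  falls by at most one when the cop retreats.\<close>

lemma near_div:
  assumes "near c c'"
  shows "(c + 1) div 4 \<le> (c' + 1) div 4 + 1"
proof -
  have "c + 1 \<le> c' + 1 + 4" using assms unfolding near_def by auto
  then have "(c + 1) div 4 \<le> (c' + 1 + 4) div 4" by (rule div_le_mono)
  then show ?thesis by simp
qed

text \<open>The conclusion provides the hypotheses of \<open>delay_big\<close>. A robber behind and
  within reach goes to distance 2 from the cop, or to distance 5 if it stood 4 behind on a vertex
  other than 1. Ahead, residues 1, 2, 3 become 2 by a step of +1 or -3, by staying, or by a step of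
  -1. Residue 0 ahead admits no such reply, by \<open>near_mod_4\<close>.\<close>

lemma evade:
  assumes "n \<ge> 6" "c \<in> {2..n}" "r \<in> {1..n}" "c \<noteq> r" "r < c \<or> (r - c) mod 4 \<noteq> 0"
  obtains r' where "r' \<in> {1..n}" "near r r'" "\<not> near c r'" "r' < c \<or> (r' - c) mod 4 = 2"
proof (cases "r < c")
  case True
  then consider "r + 1 = c" | "r + 3 = c" | "r + 4 = c" | "near c r" "r + 1 \<noteq> c" "r + 3 \<noteq> c" "r + 4 \<noteq> c"
    | "\<not> near c r" by blast
  then show thesis
  proof cases
    case 1
    show thesis
    \<comment> \<open>The vertex c - 2 is 0 for c = 2, and for c = 3 it is adjacent to the cop
      through the edge 1-3.\<close>
    proof (cases "c \<le> 3")
      case True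
      show thesis
      by (rule that[of "c + 2"]) (use True 1 assms in \<open>auto simp: near_def\<close>)
    next
      case False
      show thesis
      by (rule that[of "c - 2"]) (use False 1 assms in \<open>auto simp: near_def\<close>)
    qed
  next
    case 2
    show thesis
      by (rule that[of "r + 1"]) (use 2 assms in \<open>auto simp: near_def\<close>)
  next
    case 3
    show thesis
    proof (cases "r = 1")
      case True
      show thesis
      by (rule that[of 3]) (use True 3 assms in \<open>auto simp: near_def\<close>)
    next
      case False
      show thesis
      by (rule that[of "r - 1"]) (use False 3 assms in \<open>auto simp: near_def\<close>)
    qed
  next
    case 4
    then have rc: "r = 1 \<and> c = 3" using True by (auto simp: near_def)
    show thesis
      by (rule that[of 5]) (use rc assms in \<open>auto simp: near_def\<close>)
  next
    case 5
    show thesis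
      by (rule that[of r]) (use 5 True assms in \<open>simp_all\<close>)
  qed
next
  case False
  define q m where "q = (r - c) div 4" and "m = (r - c) mod 4"
  have r: "r = c + (4 * q + m)" and "m < 4"
    using False unfolding q_def m_def by simp_all
  then consider "m = 2" | "m = 3" | "m = 1" "r < n" | "m = 1" "r = n" "q = 0" | "m = 1" "q > 0"
  proof -
    have "m \<noteq> 0" using assms(5) False unfolding m_def by blast
    then have "m = 1 \<or> m = 2 \<or> m = 3" using \<open>m < 4\<close> by linarith
    moreover have "r < n \<or> r = n" using assms(3) by auto
    ultimately show thesis using that by blast
  qed
  then show thesis
  proof cases
    case 1
    show thesis
      by (rule that[of r]) (use 1 r assms in \<open>auto simp: near_def mod_Suc\<close>)
  next
    case 2
    show thesis
      by (rule that[of "r - 1"]) (use 2 r assms in \<open>auto simp: near_def mod_Suc\<close>)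
  next
    case 3
    show thesis
      by (rule that[of "r + 1"]) (use 3 r assms in \<open>auto simp: near_def mod_Suc\<close>)
  next
    case 4
    \<comment> \<open>Here r = c + 1 = n, so r - 3 = c - 2: the robber slips behind the cop.\<close>
    show thesis
      by (rule that[of "r - 3"]) (use 4 r assms in \<open>auto simp: near_def mod_Suc\<close>)
  next
    case 5
    then obtain p where "q = Suc p" by (cases q) auto
    then have p: "r = c + (4 * p + 2) + 3" using r 5 by simp
    show thesis
      by (rule that[of "c + (4 * p + 2)"]) (use p assms in \<open>auto simp: near_def mod_Suc\<close>)
  qed
qed

lemma delay_big:
  assumes "\<not> near c r" "c \<noteq> 1" "r < c \<or> (r - c) mod 4 = 2"
  shows "delay n c r = n - 4 + (c + 1) div 4"
  using assms by (auto simp: delay_def)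

section \<open>One robber: the cop can lower the delay in every round\<close>

text \<open>Three regimes: at the large value the cop retreats; on vertex 1 with residue 2 the cop
  uses the edge 1-3; otherwise the cop advances by the residue, with 4 in place of 0.\<close>

lemma chase_step:
  assumes "n \<ge> 10" "c \<in> {1..n}" "r \<in> {1..n}" "\<not> near c r"
  obtains c' where "c' \<in> {1..n}" "near c c'"
    "\<And>r'. r' \<in> {1..n} \<Longrightarrow> near r r' \<Longrightarrow> delay n c' r' < delay n c r"
proof -
  define m where "m = (r - c) mod 4"
  show thesis
  proof (cases "c \<noteq> 1 \<and> (r < c \<or> m = 2)")
    case True
    show thesis
    proof (rule chase_step_back[of n c r])
      show "delay n c r = n - 4 + (c + 1) div 4"
        using delay_big[of c r n] assms(4) True unfolding m_def by auto
      \<comment> \<open>For c = 2 a robber behind would stand on 1, next to the cop. So r - 2 is 2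
        modulo 4, and r is 0.\<close>
      show "c \<noteq> 2 \<or> r mod 4 = 0"
      proof (rule disjCI)
        assume "\<not> r mod 4 = 0"
        show "c \<noteq> 2"
        proof
          assume "c = 2"
          moreover from this have "r \<noteq> 1" using assms(4) by (auto simp: near_def)
          ultimately have "(r - 2) mod 4 = 2" "r \<ge> 2" using True assms(3) unfolding m_def by auto
          moreover from this obtain s where "r = 2 + s" using le_Suc_ex by blast
          ultimately show False using \<open>\<not> r mod 4 = 0\<close> by (simp add: mod_Suc)
        qed
      qed
    qed (use assms True that in auto)
  next
    case False
    have "c < r"
      using False assms(2-4) by (cases "c = r") auto
    have r: "r = c + (4 * ((r - c) div 4) + m)"
      using \<open>c < r\<close> unfolding m_def by simp
    have "m < 4" unfolding m_def by simp
    show thesis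
    proof (cases "m = 2")
      case True
      with False have "c = 1" by simp
      define q where "q = (r - c) div 4"
      have q: "r = 4 * q + 3" using r True \<open>c = 1\<close> unfolding q_def by simp
      then have "q \<ge> 1" using \<open>c = 1\<close> assms(4) by (cases q) (auto simp: near_def)
      have d: "delay n c r = n - 5"
        using True \<open>c = 1\<close> assms(4) \<open>c < r\<close> unfolding m_def by (auto simp: delay_def)
      \<comment> \<open>Here r is 3 modulo 4 and r >= 7. Seen from vertex 3, residue 2 means that r'
        is 1 modulo 4, which one step from r cannot reach.\<close>
      have "delay n 3 r' < delay n c r" if r': "r' \<in> {1..n}" "near r r'" for r'
      proof -
        have "r \<noteq> 1 \<and> r \<noteq> 3" using q \<open>q \<ge> 1\<close> by simp
        then have "r' mod 4 \<noteq> 1" using near_mod_4[OF r'(2)] q by (auto simp: doubleton_eq_iff mod_Suc)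
        moreover have "r \<le> r' + 4" using r'(2) unfolding near_def by auto
        then have "3 \<le> r'" using q \<open>q \<ge> 1\<close> by linarith
        ultimately have "(r' - 3) mod 4 \<noteq> 2"
        proof -
          obtain s where "r' = 3 + s" using \<open>3 \<le> r'\<close> le_Suc_ex by blast
          then show ?thesis using \<open>r' mod 4 \<noteq> 1\<close> by (auto simp: mod_Suc numeral_3_eq_3)
        qed
        then have "delay n 3 r' \<le> max 1 (n - 3 - 3)" using \<open>3 \<le> r'\<close> by (rule delay_forward_le[rotated])
        then show ?thesis using d assms(1) by simp
      qed
      then show thesis using that[of 3] \<open>c = 1\<close> assms(1) by (auto simp: near_def)
    next
      case False
      show thesis
      proof (cases "m = 0")
        case True
        \<comment> \<open>Residue 0 is rewritten as 4, so that the cop really advances.\<close>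
        then have "r = c + (4 * ((r - c) div 4 - 1) + 4)" using r \<open>c < r\<close> by (cases "(r - c) div 4") auto
        then show thesis
          by (rule chase_step_forward[OF assms \<open>c < r\<close>, of 4, rotated]) (use that in auto)
      next
        case False
        then have "m \<in> {1, 3, 4}" using \<open>m < 4\<close> \<open>m \<noteq> 2\<close> by auto
        then show thesis
          by (rule chase_step_forward[OF assms \<open>c < r\<close> _ r]) (use that in auto)
      qed
    qed
  qed
qed

section \<open>One robber: the delay drops by at most one per round\<close>

lemma delay_forward_le':
  assumes "c < r" "r \<le> n" "(r - c) mod 4 \<noteq> 2" "\<not> near c r"
  shows "delay n c r + c + 3 \<le> n"
proof -
  have "r \<noteq> c + 2" using assms(3) by auto
  moreover have "r \<noteq> c + 1" "r \<noteq> c + 3" "r \<noteq> c + 4" using assms(4) by (auto simp: near_def)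
  ultimately have "c + 5 \<le> r" using assms(1) by linarith
  then show ?thesis using assms by (auto simp: delay_def)
qed

text \<open>Residue 1 has the largest delay among the residues 0, 1, 3 ahead. It is reached by +1,
  or by -3 from n. For r = n = c + 4 the first leaves the graph and the second ends next to the cop:
  this is the trap that the last hypothesis excludes.\<close>

lemma evade_forced:
  assumes "n \<ge> 6" "r \<in> {1..n}" "c \<ge> 1" "r = c + 4 * q" "q \<ge> 1" "r \<noteq> n \<or> c + 4 \<noteq> n"
  obtains r' where "r' \<in> {1..n}" "near r r'" "\<not> near c r'" "delay n c r' = n - 3 - c"
proof -
  define r' where "r' = (if r < n then r + 1 else r - 3)"
  obtain p where p: "r' = c + (4 * p + 5)"
  proof (cases "r < n")
    case True
    then show thesis using that[of "q - 1"] assms r'_def by simp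
  next
    case False
    then have "q \<noteq> 1" using assms by auto
    then show thesis using that[of "q - 2"] assms r'_def False by simp
  qed
  have far: "\<not> near c r'" using p \<open>c \<ge> 1\<close> by (auto simp: near_def)
  moreover have "(r' - c) mod 4 = 1" using p by simp
  ultimately have "delay n c r' = n - 3 - c" using p by (auto simp: delay_def)
  moreover have "r' \<in> {1..n}" "near r r'" using assms unfolding r'_def near_def by auto
  ultimately show thesis using that far by blast
qed

text \<open>From vertex 1 the largest delay is n - 4, at the vertices 4p + 6, and a robber with
  \<open>r mod 4 \<noteq> 0\<close> reaches one of them. From residue 0 none is in reach, but the
  old delay was small enough: at most n - 4 for c = 2, answered by a vertex 4p + 7 of delay n - 5,
  and at most n - 6 for c = 3, 4, 5, which staying preserves. For c = 1 staying changes
  nothing.\<close>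

lemma escape_step_1:
  assumes n: "n \<ge> 10" and pos: "c \<in> {1..n}" "r \<in> {1..n}" "\<not> near c r" "near c 1"
  obtains r' where "r' \<in> {1..n}" "near r r'" "\<not> near 1 r'" "delay n c r \<le> delay n 1 r' + 1"
proof (cases "r mod 4 = 0")
  case False
  define q where "q = r div 4"
  have "r mod 4 < 4" by simp
  with False have "r mod 4 = 1 \<or> r mod 4 = 2 \<or> r mod 4 = 3" by linarith
  moreover have "r = 4 * q + r mod 4" unfolding q_def by simp
  moreover have "r \<noteq> 1" using pos by auto
  ultimately have "\<exists>p. 4 * p + 6 \<le> n \<and> near r (4 * p + 6)"
  proof (elim disjE)
    assume "r mod 4 = 1" "r = 4 * q + r mod 4" "r \<noteq> 1"
    then have r: "r = 4 * q + 1" "q \<ge> 1" by (cases q; simp)+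
    show ?thesis
    proof (cases "q = 1")
      case True
      then show ?thesis using r n by (intro exI[of _ 0]) (simp add: near_def)
    next
      case False
      then obtain p where "q = 2 + p" using r(2) le_Suc_ex[of 2 q] by auto
      then show ?thesis using r pos(2) by (intro exI[of _ p]) (simp add: near_def)
    qed
  next
    assume "r mod 4 = 2" "r = 4 * q + r mod 4"
    then have r: "r = 4 * q + 2" by simp
    show ?thesis
    proof (cases q)
      case 0
      then show ?thesis using r n by (intro exI[of _ 0]) (simp add: near_def)
    next
      case (Suc p)
      then show ?thesis using r pos(2) by (intro exI[of _ p]) (simp add: near_def)
    qed
  next
    assume "r mod 4 = 3" "r = 4 * q + r mod 4"
    then have r: "r = 4 * q + 3" by simp
    show ?thesis
    proof (cases q)
      case 0
      then show ?thesis using r n by (intro exI[of _ 0]) (simp add: near_def)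
    next
      case (Suc p)
      then show ?thesis using r pos(2) by (intro exI[of _ p]) (simp add: near_def)
    qed
  qed
  then obtain p where p: "4 * p + 6 \<le> n" "near r (4 * p + 6)" by blast
  have far: "\<not> near 1 (4 * p + 6)" by (simp add: near_def)
  then have "delay n 1 (4 * p + 6) = n - 4" by (simp add: delay_def mod_Suc)
  moreover have "delay n c r \<le> n - 4 + 1"
    using delay_le[of c n r] near_div[OF pos(4)] n pos(1) by simp
  ultimately show thesis using that[of "4 * p + 6"] p far by simp
next
  case True
  then obtain q where r: "r = 4 * q" by auto
  have c: "c = 1 \<or> c = 2 \<or> c = 3 \<or> c = 4 \<or> c = 5" using pos(1,4) by (auto simp: near_def)
  show thesis
  proof (cases "c = 2")
    case True
    \<comment> \<open>For r = 4 the vertex r - 1 = 3 is adjacent to 1, so 7 serves instead.\<close>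
    define r' where "r' = (if q = 1 then 7 else r - 1)"
    obtain p where p: "r' = 4 * p + 7"
    proof (cases "q = 1")
      case True
      then show thesis using that[of 0] r'_def by simp
    next
      case False
      then obtain p where "q = 2 + p" using r pos(2) le_Suc_ex[of 2 q] by force
      then show thesis using that[of p] r r'_def by simp
    qed
    have far: "\<not> near 1 r'" by (simp add: p near_def)
    then have "delay n 1 r' = n - 5" by (simp add: p delay_def mod_Suc)
    moreover have "delay n c r \<le> n - 4"
      using delay_le[of c n r] n True by simp
    moreover have "r' \<in> {1..n}" "near r r'" using pos(2) n r unfolding r'_def near_def by auto
    ultimately show thesis using that far by simp
  next
    case False
    then have "q \<noteq> 1" using c r pos(3) by (auto simp: near_def)
    then obtain p where "q = 2 + p" using r pos(2) le_Suc_ex[of 2 q] by force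
    then have p: "r = 4 * p + 8" using r by simp
    have far: "\<not> near 1 r" by (simp add: p near_def)
    moreover have "delay n c r \<le> delay n 1 r + 1"
    proof (cases "c = 1")
      case False
      then have "(r - c) mod 4 \<noteq> 2" using c \<open>c \<noteq> 2\<close> p by (auto simp: mod_Suc)
      then have "delay n c r + c + 3 \<le> n"
        by (intro delay_forward_le') (use c p pos in auto)
      moreover have "delay n 1 r = n - 6" using far by (simp add: p delay_def mod_Suc)
      ultimately show ?thesis using c False \<open>c \<noteq> 2\<close> by linarith
    qed simp
    ultimately show thesis using that pos(2) by simp
  qed
qed

text \<open>Counterpart of \<open>chase_step\<close>: outside the trap, the robber answers every cop
  move safely and loses at most one round. If it reaches the large value through
  \<open>evade\<close>, then \<open>near_div\<close> gives the bound; if it is a multiple of 4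
  ahead, it uses \<open>evade_forced\<close>.\<close>

lemma escape_step:
  assumes n: "n \<ge> 10" and pos: "c \<in> {1..n}" "r \<in> {1..n}" "\<not> near c r"
    and move: "c' \<in> {1..n}" "near c c'" and no_trap: "r \<noteq> n \<or> c' + 4 \<noteq> n"
  obtains r' where "r' \<in> {1..n}" "near r r'" "\<not> near c' r'" "delay n c r \<le> delay n c' r' + 1"
proof -
  have ne: "c' \<noteq> r" using pos move by auto
  have big: "delay n c r \<le> n - 4 + (c' + 1) div 4 + 1"
    using delay_le[of c n r] near_div[OF move(2)] n pos by auto
  show thesis
  proof (cases "c' = 1")
    case c': True
    show thesis
      by (rule escape_step_1[OF n pos]) (use move c' that in auto)
  next
    case c': False
    show thesis
    proof (cases "r < c' \<or> (r - c') mod 4 \<noteq> 0")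
      case True
      obtain r' where "r' \<in> {1..n}" "near r r'" "\<not> near c' r'" "r' < c' \<or> (r' - c') mod 4 = 2"
        using evade[of n c' r] n c' move(1) pos(2) ne True by auto
      then show thesis using that[of r'] delay_big[of c' r' n] big c' by simp
    next
      case False
      define q where "q = (r - c') div 4"
      have r: "r = c' + 4 * q" using False unfolding q_def by auto
      then have "q \<ge> 1" using ne by (cases q) auto
      obtain r' where r': "r' \<in> {1..n}" "near r r'" "\<not> near c' r'" "delay n c' r' = n - 3 - c'"
        using evade_forced[of n r c' q] n pos move r \<open>q \<ge> 1\<close> no_trap by auto
      \<comment> \<open>A step of 1, 3 or 4 towards a robber then a multiple of 4 ahead started from
        residue 1, 3 or 0. The constants n - 3, n - 5, n - 6 in \<open>delay\<close> fit these steps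
        exactly, and n - 4 fits the step from 1 to 3, which started from residue 2.\<close>
      have "delay n c r \<le> n - 3 - c' + 1"
      proof (cases "c = 1 \<and> c' = 3")
        case True
        then have "(r - c) mod 4 = 2" using r by (simp add: mod_Suc)
        then have "delay n c r = n - 5" using pos True r by (auto simp: delay_def)
        then show ?thesis using True by simp
      next
        case False
        have "c \<le> c' + 4" using move(2) unfolding near_def by auto
        moreover have "c \<noteq> r" using pos(3) by auto
        ultimately have "c < r" using r \<open>q \<ge> 1\<close> by simp
        have "c' \<le> c + 1 \<or> c' = c + 3 \<or> c' = c + 4"
          using move(2) False unfolding near_def by auto
        then show ?thesis
        proof (elim disjE)
          assume "c' \<le> c + 1"
          have "(r - c) mod 4 \<noteq> 2"
          proof
            assume "(r - c) mod 4 = 2"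
            then obtain s where "r - c = 4 * s + 2" by (metis mult_div_mod_eq)
            then have "r = c + 2 + 4 * s" using \<open>c < r\<close> by simp
            then have "r mod 4 = (c + 2) mod 4" by (simp only: mod_mult_self2)
            moreover have "r mod 4 = c' mod 4" using r by simp
            ultimately show False
              using near_mod_4[OF move(2)] False c' by (auto simp: doubleton_eq_iff)
          qed
          then have "delay n c r + c + 3 \<le> n"
            using \<open>c < r\<close> pos by (intro delay_forward_le') auto
          then show ?thesis using \<open>c' \<le> c + 1\<close> by linarith
        next
          assume "c' = c + 3"
          moreover from this have "(r - c) mod 4 = 3" using r by simp
          ultimately show ?thesis using \<open>c < r\<close> pos by (auto simp: delay_def)
        next
          assume "c' = c + 4"
          moreover from this have "(r - c) mod 4 = 0" using r by simp
          ultimately show ?thesis using \<open>c < r\<close> pos by (auto simp: delay_def)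
        qed
      qed
      then show thesis using that r' by simp
    qed
  qed
qed

section \<open>Upper bound: hunting the robbers one after another\<close>

lemma wins_Nil: "wins n t c []"
  by (cases t) auto

text \<open>The robber on r is the current target, and each other robber is charged the maximal
  delay. While nobody is caught, the target's delay drops; when anyone is caught, target or not, one
  charge pays for an arbitrary new target.\<close>

lemma wins_upper:
  assumes n: "n \<ge> 10"
  shows "c \<in> {1..n} \<Longrightarrow> set rs \<subseteq> {1..n} \<Longrightarrow> c \<notin> set rs \<Longrightarrow> r \<in> set rs \<Longrightarrow>
    delay n c r + (length rs - 1) * (n - 4 + (n + 1) div 4) \<le> t \<Longrightarrow> wins n t c rs"
proof (induction t arbitrary: c rs r)
  case 0
  then have "c \<noteq> r" by auto
  then have "delay n c r > 0"
    using delay_gt_1[of c r n] 0 n by (cases "near c r") (auto simp: delay_def)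
  with 0 show ?case by simp
next
  case (Suc t)
  define T where "T = n - 4 + (n + 1) div 4"
  have r: "r \<in> {1..n}" "c \<noteq> r" using Suc.prems by auto
  obtain c' where c': "c' \<in> {1..n}" "near c c'"
    "c' \<noteq> r \<Longrightarrow> r' \<in> {1..n} \<Longrightarrow> near r r' \<Longrightarrow> delay n c' r' < delay n c r" for r'
  proof (cases "near c r")
    case True
    then show thesis using that[of r] r by auto
  next
    case False
    then show thesis using chase_step[OF n Suc.prems(1) r(1)] that by metis
  qed
  have "wins n t c' (filter (\<lambda>x. x \<noteq> c') rs')"
    if rs': "list_all2 (moves n) (filter (\<lambda>x. x \<noteq> c') rs) rs'" for rs'
  proof (cases "filter (\<lambda>x. x \<noteq> c') rs' = []")
    case True
    then show ?thesis by (simp add: wins_Nil)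
  next
    case False
    define rs'' where "rs'' = filter (\<lambda>x. x \<noteq> c') rs'"
    have "y \<in> {1..n}" if y: "y \<in> set rs'" for y
    proof -
      obtain i where "i < length rs'" "rs' ! i = y" using y by (auto simp: in_set_conv_nth)
      then show ?thesis
        using list_all2_nthD2[OF rs', of i] by (auto simp: legal_move_def H_vertices_def)
    qed
    then have sub: "set rs'' \<subseteq> {1..n}" "c' \<notin> set rs''" unfolding rs''_def by auto
    have len': "length rs' = length (filter (\<lambda>x. x \<noteq> c') rs)"
      using rs' by (simp add: list_all2_lengthD)
    have ne: "rs'' \<noteq> []" using False rs''_def by simp
    have len: "length rs'' \<le> length rs"
      unfolding rs''_def using length_filter_le[of "\<lambda>x. x \<noteq> c'" rs'] length_filter_le[of "\<lambda>x. x \<noteq> c'" rs] len'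
      by linarith
    have "\<exists>r'' \<in> set rs''. delay n c' r'' + (length rs'' - 1) * T \<le> t"
    proof (cases "length rs'' < length rs")
      case True
      obtain r'' where r'': "r'' \<in> set rs''" using ne by (cases rs'') auto
      then have "delay n c' r'' \<le> T"
        using delay_le_max[of c' n r''] c'(1) n unfolding T_def by simp
      then have "delay n c' r'' + (length rs'' - 1) * T \<le> Suc (length rs'' - 1) * T" by simp
      also have "\<dots> \<le> (length rs - 1) * T"
        using True ne by (intro mult_le_mono1) (cases rs''; auto)
      also have "\<dots> \<le> t"
      proof -
        have "delay n c r > 0"
          using delay_gt_1[of c r n] r Suc.prems(1) n by (cases "near c r") (auto simp: delay_def)
        then show ?thesis using Suc.prems(5) unfolding T_def by linarith
      qed
      finally show ?thesis using r'' by blast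
    next
      case False
      then have eq: "length (filter (\<lambda>x. x \<noteq> c') rs) = length rs" "length rs'' = length rs'"
        using len' len length_filter_le[of "\<lambda>x. x \<noteq> c'" rs] length_filter_le[of "\<lambda>x. x \<noteq> c'" rs']
        unfolding rs''_def by linarith+
      then have "filter (\<lambda>x. x \<noteq> c') rs = rs" "rs'' = rs'"
        unfolding rs''_def by (metis length_filter_less less_irrefl filter_True)+
      then have r_ne: "c' \<noteq> r" and lall: "list_all2 (moves n) rs rs''"
        using rs' Suc.prems(4) by (auto simp: filter_id_conv)
      \<comment> \<open>With nothing filtered out, list positions identify the robbers, so the
        target keeps its index.\<close>
      obtain i where i: "i < length rs" "rs ! i = r" using Suc.prems(4) by (auto simp: in_set_conv_nth)
      then have "moves n r (rs'' ! i)" using list_all2_nthD[OF lall, of i] by simp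
      then have "delay n c' (rs'' ! i) < delay n c r"
        using c'(3)[OF r_ne] moves_iff[of n r] r(1) n by auto
      moreover have "rs'' ! i \<in> set rs''" using i lall by (simp add: list_all2_lengthD[symmetric])
      moreover have "length rs'' = length rs" using lall by (simp add: list_all2_lengthD)
      ultimately have "delay n c' (rs'' ! i) + (length rs'' - 1) * T \<le> t" "rs'' ! i \<in> set rs''"
        using Suc.prems(5) unfolding T_def by auto
      then show ?thesis by blast
    qed
    then show ?thesis
      using Suc.IH[OF c'(1) sub] unfolding rs''_def T_def by blast
  qed
  moreover have "moves n c c'" using moves_iff[of n c] c' Suc.prems(1) n by auto
  ultimately show ?case by auto
qed

section \<open>Lower bound: spreading and regrouping at vertex n\<close>

lemma list_all2_replicate:
  "\<forall>x \<in> set xs. P x y \<Longrightarrow> list_all2 P xs (replicate (length xs) y)"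
  by (simp add: list_all2_conv_all_nth)

text \<open>If the cop enters n, n - 1 or n - 3, the others meet at n - 2, n - 3 or n - 1
  respectively, at distance 2 from the cop. As n = 4l + 2, the quotient \<open>(c + 1) div 4\<close>
  is l for all three of these c, which gives the full delay. Otherwise c is n - 5, n - 7 or n - 8
  and everyone can meet at n.\<close>

lemma regroup:
  assumes n: "n \<ge> 10" "n mod 4 = 2" and c: "c \<in> {1..n}" "near (n - 4) c" "c \<noteq> n - 4"
  obtains p where "p \<in> {1..n}" "\<not> near c p"
    "\<And>x. x \<in> {n, n - 1, n - 3} \<Longrightarrow> x \<noteq> c \<Longrightarrow> near x p"
    "c \<in> {n, n - 1, n - 3} \<Longrightarrow> delay n c p = n - 4 + (n + 1) div 4"
proof -
  obtain l where l: "n = 4 * l + 2" "l \<ge> 2"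
  proof (rule that[of "n div 4"])
    show "n = 4 * (n div 4) + 2" using n(2) mult_div_mod_eq[of 4 n] by simp
  qed (use n(1) in simp)
  have T: "(n + 1) div 4 = l" using l by simp
  obtain m where m: "n = m + 10" using n(1) le_Suc_ex[of 10 n] by auto
  have "near (m + 6) c" "c \<noteq> m + 6" using c m by (simp_all add: add.commute)
  then have "c = m + 10 \<or> c = m + 9 \<or> c = m + 7 \<or> c = m + 5 \<or> c = m + 3 \<or> c = m + 2"
    unfolding near_def by (elim disjE) simp_all
  then consider "c = n" | "c = n - 1" | "c = n - 3" | "c = n - 5" | "c = n - 7" | "c = n - 8"
    using m by auto
  then show thesis
  proof cases
    case 1
    then show thesis
      using T l by (intro that[of "n - 2"]) (auto simp: near_def delay_def)
  next
    case 2
    then show thesis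
      using T l by (intro that[of "n - 3"]) (auto simp: near_def delay_def)
  next
    case 3
    then show thesis
      using T l by (intro that[of "n - 1"]) (auto simp: near_def delay_def)
  next
    case 4
    then show thesis using l by (intro that[of n]) (auto simp: near_def)
  next
    case 5
    then show thesis using l by (intro that[of n]) (auto simp: near_def)
  next
    case 6
    then show thesis using l by (intro that[of n]) (auto simp: near_def)
  qed
qed

text \<open>The cop must be on n - 5, n - 7 or n - 8, where the three formulas for residues 1, 3, 0
  all give 2. So after the cop enters the trap, at most one round of the single-robber count
  remains, which matches the 1 in the bound for spread robbers.\<close>

lemma trap_delay:
  assumes "n \<ge> 10" "c \<in> {1..n}" "near c (n - 4)" "\<not> near c n"
  shows "delay n c n \<le> 2"
proof -
  obtain m where m: "n = m + 10" using assms(1) le_Suc_ex[of 10 n] by auto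
  have "near c (m + 6)" using assms(3) m by (simp add: add.commute)
  then have "c = m + 10 \<or> c = m + 9 \<or> c = m + 7 \<or> c = m + 6 \<or> c = m + 5 \<or> c = m + 3 \<or> c = m + 2"
    unfolding near_def by (elim disjE) simp_all
  moreover have "near (m + 10) n" "near (m + 9) n" "near (m + 7) n" "near (m + 6) n"
    using m by (simp_all add: near_def)
  ultimately have "c = m + 5 \<or> c = m + 3 \<or> c = m + 2" using assms(4) by blast
  then show ?thesis using assms(4) m by (elim disjE) (simp_all add: delay_def)
qed

text \<open>Two invariants carried by one induction, since play alternates between them: k robbers
  gathered on one vertex, and robbers spread over distinct vertices next to a cop on n - 4.
  Distinctness means that a cop move catches at most one of the spread robbers.\<close>

lemma wins_lower:
  assumes n: "n \<ge> 10" "n mod 4 = 2"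
  defines "T \<equiv> n - 4 + (n + 1) div 4"
  shows "(\<forall>c r k. c \<in> {1..n} \<longrightarrow> r \<in> {1..n} \<longrightarrow> \<not> near c r \<longrightarrow> 1 \<le> k \<longrightarrow> k \<le> 3 \<longrightarrow>
            t < delay n c r + (k - 1) * T \<longrightarrow> \<not> wins n t c (replicate k r)) \<and>
         (\<forall>rs. distinct rs \<longrightarrow> rs \<noteq> [] \<longrightarrow> set rs \<subseteq> {n, n - 1, n - 3} \<longrightarrow>
            t < 1 + (length rs - 1) * T \<longrightarrow> \<not> wins n t (n - 4) rs)"
proof (induction t)
  case 0
  then show ?case by auto
next
  case (Suc t)
  note gathered = Suc.IH[THEN conjunct1, rule_format]
  note split = Suc.IH[THEN conjunct2, rule_format]
  show ?case
  proof (intro conjI allI impI notI)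
    fix c r k
    assume c: "c \<in> {1..n}" and r: "r \<in> {1..n}" and far: "\<not> near c r" and k: "1 \<le> k" "k \<le> 3"
      and t: "Suc t < delay n c r + (k - 1) * T"
      and w: "wins n (Suc t) c (replicate k r)"
    obtain c' where c': "moves n c c'" and w': "\<And>rs'. list_all2 (moves n) (filter (\<lambda>x. x \<noteq> c') (replicate k r)) rs' \<Longrightarrow>
        wins n t c' (filter (\<lambda>x. x \<noteq> c') rs')"
      using w k by auto
    have move: "c' \<in> {1..n}" "near c c'" using c' moves_iff[of n c c'] c n by auto
    then have ne: "r \<noteq> c'" using far by auto
    show False
    proof (cases "r = n \<and> c' + 4 = n")
      case False
      then obtain r' where r': "r' \<in> {1..n}" "near r r'" "\<not> near c' r'" "delay n c r \<le> delay n c' r' + 1"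
        using escape_step[OF n(1) c r far move] by blast
      have "list_all2 (moves n) (replicate k r) (replicate k r')"
        using r' moves_iff[of n r r'] r n by (auto simp: list_all2_conv_all_nth)
      moreover have "r' \<noteq> c'" using r' by auto
      ultimately have "wins n t c' (replicate k r')"
        using w'[of "replicate k r'"] ne by simp
      then show False
        using gathered[OF move(1) r'(1,3) k] r'(4) t by simp
    next
      case True
      \<comment> \<open>Trapped on n, the robbers can go only to n, n - 1, n - 3 or onto the cop.
        The three safe choices are where k <= 3 enters.\<close>
      define rs where "rs = take k [n, n - 1, n - 3]"
      have len: "length rs = k" using k unfolding rs_def by simp
      have sub: "set rs \<subseteq> {n, n - 1, n - 3}"
        using set_take_subset[of k "[n, n - 1, n - 3]"] unfolding rs_def by auto
      have "near n (n - 1)" "near n (n - 3)" using n(1) by (simp_all add: near_def)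
      then have "moves n n x" if "x \<in> {n, n - 1, n - 3}" for x
        using that n(1) moves_iff[of n n x] by (elim insertE) auto
      moreover have "rs ! i \<in> {n, n - 1, n - 3}" if "i < k" for i
        using sub nth_mem[of i rs] that len by blast
      ultimately have "list_all2 (moves n) (replicate k r) rs"
        using True len by (simp add: list_all2_conv_all_nth)
      moreover have "filter (\<lambda>x. x \<noteq> c') rs = rs"
        using sub True n(1) by (auto simp: filter_id_conv)
      ultimately have "wins n t c' rs" using w'[of rs] ne by simp
      moreover have "c' = n - 4" using True by linarith
      moreover have "delay n c r \<le> 2"
        using trap_delay[of n c] n(1) c True move far \<open>c' = n - 4\<close> by simp
      moreover have "distinct rs" "rs \<noteq> []" using n(1) k len unfolding rs_def by (auto intro!: distinct_take)
      ultimately show False using split[of rs] sub t len by simp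
    qed
  next
    fix rs
    assume rs: "distinct rs" "rs \<noteq> []" "set rs \<subseteq> {n, n - 1, n - 3}"
      and t: "Suc t < 1 + (length rs - 1) * T"
      and w: "wins n (Suc t) (n - 4) rs"
    obtain c' where c': "moves n (n - 4) c'" and w': "\<And>rs'. list_all2 (moves n) (filter (\<lambda>x. x \<noteq> c') rs) rs' \<Longrightarrow>
        wins n t c' (filter (\<lambda>x. x \<noteq> c') rs')"
      using w rs(2) by auto
    have move: "c' \<in> {1..n}" "near (n - 4) c'" using c' moves_iff[of n "n - 4" c'] n by auto
    have len3: "length rs \<le> 3"
    proof -
      have "card (set rs) \<le> card {n, n - 1, n - 3}" by (rule card_mono) (use rs in auto)
      also have "\<dots> \<le> 3" by (auto simp: card_insert_if)
      finally show ?thesis using rs(1) by (simp add: distinct_card)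
    qed
    show False
    proof (cases "c' = n - 4")
      \<comment> \<open>A waiting cop is answered by waiting robbers.\<close>
      case True
      then have "filter (\<lambda>x. x \<noteq> c') rs = rs" using rs(3) n(1) by (auto simp: filter_id_conv)
      moreover have "list_all2 (moves n) rs rs"
        using rs(3) n(1) by (intro list.rel_refl_strong) (auto simp: legal_move_def H_vertices_def)
      ultimately have "wins n t (n - 4) rs" using w'[of rs] True by simp
      then show False using split[OF rs] t by simp
    next
      case False
      obtain p where p: "p \<in> {1..n}" "\<not> near c' p"
        "\<And>x. x \<in> {n, n - 1, n - 3} \<Longrightarrow> x \<noteq> c' \<Longrightarrow> near x p"
        "c' \<in> {n, n - 1, n - 3} \<Longrightarrow> delay n c' p = T"
        using regroup[OF n move False] unfolding T_def by blast
      define k where "k = length (filter (\<lambda>x. x \<noteq> c') rs)"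
      have "moves n x p" if "x \<in> set (filter (\<lambda>x. x \<noteq> c') rs)" for x
      proof -
        have "x \<in> {n, n - 1, n - 3}" "x \<noteq> c'" using that rs(3) by auto
        moreover from this have "x \<in> {1..n}" using n(1) by auto
        ultimately show ?thesis using moves_iff[of n x p] p(1,3) n(1) by simp
      qed
      then have "wins n t c' (filter (\<lambda>x. x \<noteq> c') (replicate k p))"
        using w'[of "replicate k p"] unfolding k_def by (simp add: list_all2_replicate)
      moreover have "p \<noteq> c'" using p(2) by auto
      ultimately have win: "wins n t c' (replicate k p)" by simp
      have k: "k \<le> 3" unfolding k_def using len3 length_filter_le le_trans by blast
      have "1 \<le> k \<and> t < delay n c' p + (k - 1) * T"
      \<comment> \<open>If one robber was caught, the rest have delay \<open>T\<close> at p, which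
        replaces the lost summand. If none was, (k - 1) * T alone exceeds t.\<close>
      proof (cases "c' \<in> set rs")
        case True
        have "filter (\<lambda>x. x \<noteq> c') rs = remove1 c' rs"
          using distinct_remove1_removeAll[OF rs(1)] by (simp add: removeAll_filter_not_eq eq_commute)
        then have "k = length rs - 1" using True unfolding k_def by (simp add: length_remove1)
        moreover have "length rs - 1 \<noteq> 0" using t by (intro notI) simp
        ultimately have "k \<ge> 1" "t < k * T" using t by auto
        moreover have "k * T = T + (k - 1) * T" using \<open>k \<ge> 1\<close> by (cases k) auto
        ultimately show ?thesis using p(4) True rs(3) by auto
      next
        case False
        then have "filter (\<lambda>x. x \<noteq> c') rs = rs" by (auto simp: filter_id_conv)
        then have "k = length rs" unfolding k_def by simp
        then show ?thesis using t rs(2) by (cases rs) auto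
      qed
      then show False using gathered[OF move(1) p(1,2) _ k] win by blast
    qed
  qed
qed

section \<open>Starting positions and the value of the game\<close>

text \<open>For c >= 2 a vertex at distance 2 from the cop has the large delay. From vertex 1 the
  largest delay is n - 4, attained at 6.\<close>

lemma far_start:
  assumes "n \<ge> 10" "c \<in> {1..n}"
  obtains r where "r \<in> {1..n}" "\<not> near c r" "delay n c r \<ge> n - 4"
proof -
  consider "c = 1" | "c \<noteq> 1" "c + 2 \<le> n" | "c + 2 > n" by linarith
  then show thesis
  proof cases
    case 1
    then show thesis using assms by (intro that[of 6]) (auto simp: near_def delay_def)
  next
    case 2
    then show thesis using assms by (intro that[of "c + 2"]) (auto simp: near_def delay_def)
  next
    case 3
    then have "\<not> near c (c - 2)" using assms by (auto simp: near_def)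
    then show thesis using assms 3 by (intro that[of "c - 2"]) (auto simp: delay_def)
  qed
qed

text \<open>Vertex 1 is an optimal start: \<open>(1 + 1) div 4 = 0\<close> limits the first target
  to n - 4 rounds, and by \<open>far_start\<close> no start does better. Each of the two remaining
  robbers adds the maximal delay.\<close>

lemma capt_le_iff:
  assumes n: "n \<ge> 10" "n mod 4 = 2"
  shows "capt_le (H_vertices n) (H_edge n) 3 t \<longleftrightarrow> (n - 4) + 2 * (n - 4 + (n + 1) div 4) \<le> t"
proof
  assume "capt_le (H_vertices n) (H_edge n) 3 t"
  then obtain c where c: "c \<in> {1..n}"
    and w: "\<And>rs. length rs = 3 \<Longrightarrow> set rs \<subseteq> {1..n} \<Longrightarrow> wins n t c (filter (\<lambda>r. r \<noteq> c) rs)"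
    by (auto simp: capt_le_def H_vertices_def)
  obtain r where r: "r \<in> {1..n}" "\<not> near c r" "delay n c r \<ge> n - 4" using far_start[OF n(1) c] .
  have "r \<noteq> c" using r(2) by auto
  then have "wins n t c (replicate 3 r)" using w[of "replicate 3 r"] r(1) by simp
  then show "(n - 4) + 2 * (n - 4 + (n + 1) div 4) \<le> t"
    using wins_lower[OF n, of t, THEN conjunct1, rule_format, OF c r(1,2), of 3] r(3) by fastforce
next
  assume t: "(n - 4) + 2 * (n - 4 + (n + 1) div 4) \<le> t"
  have "wins n t 1 (filter (\<lambda>r. r \<noteq> 1) rs)" if rs: "length rs = 3" "set rs \<subseteq> {1..n}" for rs
  proof (cases "filter (\<lambda>r. r \<noteq> 1) rs")
    case Nil
    then show ?thesis by (simp add: wins_Nil)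
  next
    case (Cons r rs')
    have "delay n 1 r \<le> n - 4" using delay_le[of 1 n r] n(1) by simp
    moreover have "length (filter (\<lambda>r. r \<noteq> 1) rs) - 1 \<le> 2"
      using length_filter_le[of "\<lambda>r. r \<noteq> 1" rs] rs(1) by simp
    then have "(length (filter (\<lambda>r. r \<noteq> 1) rs) - 1) * (n - 4 + (n + 1) div 4)
        \<le> 2 * (n - 4 + (n + 1) div 4)" by (rule mult_le_mono1)
    ultimately have "delay n 1 r + (length (filter (\<lambda>r. r \<noteq> 1) rs) - 1) * (n - 4 + (n + 1) div 4) \<le> t"
      using t by linarith
    moreover have "r \<in> set (filter (\<lambda>r. r \<noteq> 1) rs)" unfolding Cons by simp
    ultimately show ?thesis
      by (intro wins_upper[OF n(1), of 1 _ r]) (use n(1) rs(2) in auto)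
  qed
  then show "capt_le (H_vertices n) (H_edge n) 3 t"
    using n(1) unfolding capt_le_def by (intro bexI[of _ 1]) (auto simp: H_vertices_def)
qed

theorem mainTheorem5:
  fixes l n :: nat
  assumes "l \<ge> 2" and "n = 4 * l + 2"
  shows "capt (H_vertices n) (H_edge n) 3 = 2 * l + 3 * (n - 4)"
proof -
  have n: "n \<ge> 10" "n mod 4 = 2" "(n + 1) div 4 = l" using assms by (simp_all add: mod_Suc)
  show ?thesis
    unfolding capt_def capt_le_iff[OF n(1,2)] n(3)
    by (rule Least_equality) simp_all
qed

end
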